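(* Let $X$ and $Y$ be (real, Hausdorff) locally convex topological vector spaces, $Y^*$ the dual space of $Y$, and let $\partial U^*$ be the boundary of a convex closed bounded absorbing set $U^*\subset Y^*$. Let $f:D(f)\subseteq X\to Y$ be a (single-valued or multi-valued) mapping and let $G\subseteq D(f)$ be such that one of the following conditions holds: i) $f(G)$ is a convex set with nonempty interior in $Y$; ii) $f(G)$ is an open (or closed) convex set in $Y$. Suppose that for every linear continuous functional $y^*\in\partial U^*$ there exists $x\in G$ such that, in case i), $$\{\langle y^*,y\rangle: y\in f(x)\}\cap(0,\infty)\ne\varnothing,$$ and, in case ii), $$\{\langle y^*,y\rangle: y\in f(x)\}\cap[0,\infty)\ne\varnothing .$$ Then $0\in f(G)$.
   Context: No continuity of $f$ is assumed. A multi-valued mapping assigns to each $x\in D(f)$ a nonempty subset $f(x)\subseteq Y$; $f(G)=\bigcup_{x\in G}f(x)$. $\langle\cdot,\cdot\rangle$ is the duality pairing between $Y^*$ and $Y$. The dual $Y^*$ carries its strong topology (the norm topology when $Y$ is normed); e.g. when $Y$ is a normed space, $\partial U^*$ may be any sphere centered at $0$ in $Y^*$.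
   Formalization: The formal theorem additionally assumes that G is nonempty when Y = {0}; otherwise Y = {0}, U* = {0} (empty boundary) and G = ∅ satisfy condition ii) vacuously while 0 is not in f(G). *)

theory Defs
  imports "HOL-Analysis.Analysis"
begin

section \<open>Real Hausdorff locally convex topological vector spaces\<close>

class locally_convex_space = real_vector + t2_space + topological_ab_group_add +
  assumes tendsto_scaleR_Pair:
    "LIM p (nhds a \<times>\<^sub>F nhds x). fst p *\<^sub>R snd p :> nhds (a *\<^sub>R x)"
  assumes locally_convex_zero:
    "open V \<Longrightarrow> 0 \<in> V \<Longrightarrow> \<exists>W. open W \<and> 0 \<in> W \<and> W \<subseteq> V \<and>
       (\<forall>x\<in>W. \<forall>y\<in>W. \<forall>u\<ge>0. \<forall>v\<ge>0. u + v = 1 \<longrightarrow> u *\<^sub>R x + v *\<^sub>R y \<in> W)"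

text \<open>The last conjunct spells out \<^const>\<open>convex\<close>, which cannot be used inside the class
  specification because its type carries the sort constraint \<^class>\<open>real_vector\<close>.\<close>

lemma locally_convex_nhd:
  fixes V :: "'a::locally_convex_space set"
  assumes "open V" "0 \<in> V"
  obtains W where "open W" "0 \<in> W" "W \<subseteq> V" "convex W"
  using locally_convex_zero[OF assms] unfolding convex_def by blast

instance real_normed_vector \<subseteq> locally_convex_space
proof
  fix a :: real and x :: 'a
  show "LIM p (nhds a \<times>\<^sub>F nhds x). fst p *\<^sub>R snd p :> nhds (a *\<^sub>R x)"
    by (intro tendsto_scaleR filterlim_fst filterlim_snd)
next
  fix V :: "'a set" assume "open V" "0 \<in> V"
  then obtain e where "e > 0" "ball 0 e \<subseteq> V" by (auto simp: open_contains_ball)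
  then show "\<exists>W. open W \<and> 0 \<in> W \<and> W \<subseteq> V \<and>
      (\<forall>x\<in>W. \<forall>y\<in>W. \<forall>u\<ge>0. \<forall>v\<ge>0. u + v = 1 \<longrightarrow> u *\<^sub>R x + v *\<^sub>R y \<in> W)"
    unfolding convex_def[symmetric] by (intro exI[of _ "ball 0 e"]) auto
qed

text \<open>Boundedness in the sense of topological vector spaces: every neighbourhood of the origin
  absorbs the set.  The constant \<^const>\<open>bounded\<close> is only available in metric spaces.\<close>

definition tvs_bounded :: "'a::{real_vector, topological_space} set \<Rightarrow> bool" where
  "tvs_bounded B \<longleftrightarrow>
     (\<forall>V. open V \<and> 0 \<in> V \<longrightarrow> (\<exists>s>0. \<forall>t>s. B \<subseteq> (*\<^sub>R) t ` V))"

definition absorbing :: "'a::real_vector set \<Rightarrow> bool" where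
  "absorbing A \<longleftrightarrow> (\<forall>x. \<exists>r>0. \<forall>t. \<bar>t\<bar> \<le> r \<longrightarrow> t *\<^sub>R x \<in> A)"

lemma tvs_bounded_Un: "tvs_bounded A \<Longrightarrow> tvs_bounded B \<Longrightarrow> tvs_bounded (A \<union> B)"
  unfolding tvs_bounded_def
proof (intro allI impI)
  fix V :: "'a set"
  assume A: "\<forall>V. open V \<and> 0 \<in> V \<longrightarrow> (\<exists>s>0. \<forall>t>s. A \<subseteq> (*\<^sub>R) t ` V)"
    and B: "\<forall>V. open V \<and> 0 \<in> V \<longrightarrow> (\<exists>s>0. \<forall>t>s. B \<subseteq> (*\<^sub>R) t ` V)"
    and V: "open V \<and> 0 \<in> V"
  from A[rule_format, OF V] obtain s where s: "s > 0" "\<forall>t>s. A \<subseteq> (*\<^sub>R) t ` V"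
    by (elim exE conjE)
  from B[rule_format, OF V] obtain s' where s': "s' > 0" "\<forall>t>s'. B \<subseteq> (*\<^sub>R) t ` V"
    by (elim exE conjE)
  show "\<exists>s>0. \<forall>t>s. A \<union> B \<subseteq> (*\<^sub>R) t ` V"
    using s s' by (intro exI[of _ "max s s'"]) simp
qed

lemma tvs_bounded_empty: "tvs_bounded {}"
  unfolding tvs_bounded_def by (auto intro: exI[of _ 1])


section \<open>The topological dual with its strong topology\<close>

typedef (overloaded) 'a top_dual = "{\<phi> :: 'a::locally_convex_space \<Rightarrow> real. linear \<phi> \<and> continuous_on UNIV \<phi>}"
  morphisms pairing Abs_top_dual
  by (rule exI[of _ "\<lambda>_. 0"]) (auto intro: linear_zero)

setup_lifting type_definition_top_dual

lemma linear_pairing: "linear (pairing \<phi>)"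
  and continuous_on_pairing: "continuous_on UNIV (pairing \<phi>)"
  using pairing[of \<phi>] by auto

lemma top_dual_eqI: "(\<And>y. pairing \<phi> y = pairing \<psi> y) \<Longrightarrow> \<phi> = \<psi>"
  by (metis ext pairing_inject)

instantiation top_dual :: (locally_convex_space) real_vector
begin

lift_definition zero_top_dual :: "'a top_dual" is "\<lambda>_. 0"
  by (auto intro: linear_zero)

lift_definition plus_top_dual :: "'a top_dual \<Rightarrow> 'a top_dual \<Rightarrow> 'a top_dual"
  is "\<lambda>\<phi> \<psi> y. \<phi> y + \<psi> y"
  by (auto intro: linear_compose_add continuous_on_add)

lift_definition uminus_top_dual :: "'a top_dual \<Rightarrow> 'a top_dual" is "\<lambda>\<phi> y. - \<phi> y"
  by (auto intro: linear_compose_neg continuous_on_minus)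

lift_definition minus_top_dual :: "'a top_dual \<Rightarrow> 'a top_dual \<Rightarrow> 'a top_dual"
  is "\<lambda>\<phi> \<psi> y. \<phi> y - \<psi> y"
  by (auto intro: linear_compose_sub continuous_on_diff)

lift_definition scaleR_top_dual :: "real \<Rightarrow> 'a top_dual \<Rightarrow> 'a top_dual" is "\<lambda>c \<phi> y. c * \<phi> y"
  by (auto intro: linear_compose_scale_right[where 'b = real, simplified] continuous_on_mult_left)

instance
  by standard
    (simp_all add: pairing_inject[symmetric] fun_eq_iff zero_top_dual.rep_eq plus_top_dual.rep_eq
      uminus_top_dual.rep_eq minus_top_dual.rep_eq scaleR_top_dual.rep_eq algebra_simps)

end

text \<open>The strong topology is the topology of uniform convergence on the bounded subsets of the
  underlying space.\<close>

instantiation top_dual :: (locally_convex_space) topological_space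
begin

definition open_top_dual :: "'a top_dual set \<Rightarrow> bool" where
  "open_top_dual W \<longleftrightarrow>
     (\<forall>\<phi>\<in>W. \<exists>B e. tvs_bounded B \<and> e > 0 \<and>
        {\<psi>. \<forall>y\<in>B. \<bar>pairing \<psi> y - pairing \<phi> y\<bar> < e} \<subseteq> W)"

instance
proof
  show "open (UNIV :: 'a top_dual set)"
    unfolding open_top_dual_def
    by (auto intro!: exI[of _ "{}"] exI[of _ 1] tvs_bounded_empty)
next
  fix S T :: "'a top_dual set"
  assume S: "open S" and T: "open T"
  show "open (S \<inter> T)"
    unfolding open_top_dual_def
  proof
    fix \<phi> assume "\<phi> \<in> S \<inter> T"
    then have "\<phi> \<in> S" "\<phi> \<in> T" by auto
    obtain A d where A: "tvs_bounded A" "d > 0"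
        "{\<psi>. \<forall>y\<in>A. \<bar>pairing \<psi> y - pairing \<phi> y\<bar> < d} \<subseteq> S"
      using S[unfolded open_top_dual_def, rule_format, OF \<open>\<phi> \<in> S\<close>] by (elim exE conjE)
    obtain B e where B: "tvs_bounded B" "e > 0"
        "{\<psi>. \<forall>y\<in>B. \<bar>pairing \<psi> y - pairing \<phi> y\<bar> < e} \<subseteq> T"
      using T[unfolded open_top_dual_def, rule_format, OF \<open>\<phi> \<in> T\<close>] by (elim exE conjE)
    from A B show "\<exists>B e. tvs_bounded B \<and> e > 0 \<and>
        {\<psi>. \<forall>y\<in>B. \<bar>pairing \<psi> y - pairing \<phi> y\<bar> < e} \<subseteq> S \<inter> T"
      by (intro exI[of _ "A \<union> B"] exI[of _ "min d e"]) (auto intro: tvs_bounded_Un)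
  qed
next
  fix K :: "'a top_dual set set"
  assume "\<forall>S\<in>K. open S"
  then show "open (\<Union>K)"
    unfolding open_top_dual_def by (meson Union_iff Union_upper subset_trans)
qed

end


section \<open>Multi-valued mappings\<close>

definition multi_image :: "('a \<Rightarrow> 'b set) \<Rightarrow> 'a set \<Rightarrow> 'b set" where
  "multi_image f G = (\<Union>x\<in>G. f x)"

end

theory Submission
  imports Defs
begin

text \<open>If the origin is missing from the convex image, a nonzero continuous functional is
  nonnegative on the image (strictly positive in case ii); a suitable negative multiple of it lies
  on the frontier of \<open>U\<close>, where the hypothesis contradicts its sign.  The functional comes from
  a maximal convex cone \<open>K\<close> avoiding the origin: such a cone is the positive cone of a
  total order, and an interior point \<open>a\<close> of the convex set is an order unit, so that
  \<open>x \<mapsto> Sup {t. x - t *\<^sub>R a \<in> K}\<close> is linear.\<close>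

section \<open>Continuity of lines in a locally convex space\<close>

lemma tendsto_scaleR_lcs:
  fixes g :: "'b \<Rightarrow> 'a::locally_convex_space"
  assumes "(r \<longlongrightarrow> c) F" "(g \<longlongrightarrow> x) F"
  shows "((\<lambda>z. r z *\<^sub>R g z) \<longlongrightarrow> c *\<^sub>R x) F"
  using filterlim_compose[OF tendsto_scaleR_Pair filterlim_Pair[OF assms]] by simp

lemma continuous_on_scaleR_lcs:
  fixes g :: "'b::topological_space \<Rightarrow> 'a::locally_convex_space"
  assumes "continuous_on S r" "continuous_on S g"
  shows "continuous_on S (\<lambda>z. r z *\<^sub>R g z)"
  using assms unfolding continuous_on_def by (auto intro: tendsto_scaleR_lcs)

text \<open>Pull \<open>A\<close> back along the continuous line through \<open>a\<close> in
  direction \<open>x\<close>. Topological interior points thereby become algebraic ones, which is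
  what the order argument needs.\<close>

lemma open_absorbs_direction:
  fixes A :: "'a::locally_convex_space set"
  assumes "open A" "a \<in> A"
  obtains e where "e > 0" "\<And>t. \<bar>t\<bar> < e \<Longrightarrow> a + t *\<^sub>R x \<in> A"
proof -
  have "open ((\<lambda>t. a + t *\<^sub>R x) -` A)"
    using assms(1) by (intro open_vimage continuous_on_add continuous_on_scaleR_lcs) auto
  moreover have "0 \<in> (\<lambda>t. a + t *\<^sub>R x) -` A" using assms(2) by simp
  ultimately obtain e where "e > 0" "ball 0 e \<subseteq> (\<lambda>t. a + t *\<^sub>R x) -` A"
    by (rule openE)
  then show thesis by (intro that[of e]) (auto simp: subset_iff dist_real_def)
qed

section \<open>Convex cones as strict vector orders\<close>

text \<open>Such a \<open>K\<close> is the set of strictly positive elements of an ordered vector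
  space: x < y means that \<open>y - x\<close> lies in \<open>K\<close>, and leaving out 0 is
  irreflexivity.\<close>

definition blunt_convex_cone :: "'a::real_vector set \<Rightarrow> bool" where
  "blunt_convex_cone K \<longleftrightarrow>
     0 \<notin> K \<and> (\<forall>x\<in>K. \<forall>y\<in>K. x + y \<in> K) \<and> (\<forall>c>0. \<forall>x\<in>K. c *\<^sub>R x \<in> K)"

lemma blunt_convex_coneD:
  assumes "blunt_convex_cone K"
  shows "0 \<notin> K" "x \<in> K \<Longrightarrow> y \<in> K \<Longrightarrow> x + y \<in> K" "c > 0 \<Longrightarrow> x \<in> K \<Longrightarrow> c *\<^sub>R x \<in> K"
  using assms unfolding blunt_convex_cone_def by auto

text \<open>A sum of positive multiples \<open>c u\<close> and \<open>d v\<close> is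
  \<open>c + d\<close> times the convex combination with weights \<open>c / (c + d)\<close> and
  \<open>d / (c + d)\<close>.\<close>

lemma blunt_convex_cone_of_convex:
  assumes "convex C" "0 \<notin> C"
  shows "blunt_convex_cone {c *\<^sub>R x | c x. c > 0 \<and> x \<in> C}"
  unfolding blunt_convex_cone_def
proof (intro conjI ballI allI impI)
  show "0 \<notin> {c *\<^sub>R x | c x. c > 0 \<and> x \<in> C}" using assms(2) by auto
next
  fix x y assume "x \<in> {c *\<^sub>R x | c x. c > 0 \<and> x \<in> C}" "y \<in> {c *\<^sub>R x | c x. c > 0 \<and> x \<in> C}"
  then obtain c u d v where *: "c > 0" "u \<in> C" "x = c *\<^sub>R u" "d > 0" "v \<in> C" "y = d *\<^sub>R v"
    by auto
  have "(c / (c + d)) *\<^sub>R u + (d / (c + d)) *\<^sub>R v \<in> C"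
    using * assms(1) by (intro convexD) (auto simp flip: add_divide_distrib)
  moreover have "x + y = (c + d) *\<^sub>R ((c / (c + d)) *\<^sub>R u + (d / (c + d)) *\<^sub>R v)"
    using * by (simp add: scaleR_add_right)
  ultimately show "x + y \<in> {c *\<^sub>R x | c x. c > 0 \<and> x \<in> C}"
    using * add_pos_pos by blast
next
  fix b :: real and x assume "b > 0" "x \<in> {c *\<^sub>R x | c x. c > 0 \<and> x \<in> C}"
  then obtain c u where "c > 0" "u \<in> C" "x = c *\<^sub>R u" by auto
  then have "b *\<^sub>R x = (b * c) *\<^sub>R u" "b * c > 0" using \<open>b > 0\<close> by auto
  then show "b *\<^sub>R x \<in> {c *\<^sub>R x | c x. c > 0 \<and> x \<in> C}" using \<open>u \<in> C\<close> by blast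
qed

text \<open>Zorn's lemma gives a maximal cone. If it contained neither \<open>x\<close> nor
  \<open>- x\<close>, adjoining the positive ray through \<open>x\<close> would produce a strictly
  larger one.\<close>

lemma total_blunt_convex_cone_extension:
  assumes "blunt_convex_cone P"
  obtains K where "blunt_convex_cone K" "P \<subseteq> K" "\<And>x. x \<noteq> 0 \<Longrightarrow> x \<in> K \<or> - x \<in> K"
proof -
  define F where "F = {K. blunt_convex_cone K \<and> P \<subseteq> K}"
  have "\<exists>M\<in>F. \<forall>X\<in>F. M \<subseteq> X \<longrightarrow> X = M"
  proof (rule subset_Zorn_nonempty)
    show "F \<noteq> {}" using assms unfolding F_def by auto
  next
    fix \<C> assume ne: "\<C> \<noteq> {}" and ch: "subset.chain F \<C>"
    have F: "K \<in> \<C> \<Longrightarrow> blunt_convex_cone K \<and> P \<subseteq> K" for K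
      using ch unfolding subset_chain_def F_def by auto
    \<comment> \<open>Of the two chain members containing the summands, the larger contains
      both.\<close>
    have "x + y \<in> \<Union>\<C>" if xy: "x \<in> \<Union>\<C>" "y \<in> \<Union>\<C>" for x y
    proof -
      obtain K L where KL: "K \<in> \<C>" "x \<in> K" "L \<in> \<C>" "y \<in> L" using xy by auto
      then have "K \<subseteq> L \<or> L \<subseteq> K" using ch unfolding subset_chain_def by blast
      then show ?thesis
        using KL F blunt_convex_coneD(2) by (metis UnionI subsetD)
    qed
    then have "blunt_convex_cone (\<Union>\<C>)"
      using F unfolding blunt_convex_cone_def by (auto; blast)
    then show "\<Union>\<C> \<in> F" using F ne unfolding F_def by auto
  qed
  then obtain K where K: "blunt_convex_cone K" "P \<subseteq> K"
    and max: "\<And>X. blunt_convex_cone X \<Longrightarrow> K \<subseteq> X \<Longrightarrow> X = K"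
    unfolding F_def by (smt (verit) mem_Collect_eq order_trans)
  note Kc = blunt_convex_coneD[OF K(1)]
  have "x \<in> K \<or> - x \<in> K" if "x \<noteq> 0" for x
  proof (rule ccontr)
    assume no: "\<not> ?thesis"
    \<comment> \<open>The cone generated by \<open>K\<close> and \<open>x\<close>. The value
      \<open>k = 0\<close> is allowed separately since 0 is not in \<open>K\<close>; it puts
      \<open>x\<close> itself into \<open>X\<close>.\<close>
    define X where "X = K \<union> {k + s *\<^sub>R x | k s. s > 0 \<and> (k \<in> K \<or> k = 0)}"
    have [intro]: "s > 0 \<Longrightarrow> k \<in> K \<or> k = 0 \<Longrightarrow> k + s *\<^sub>R x \<in> X" "k \<in> K \<Longrightarrow> k \<in> X" for k s
      unfolding X_def by auto
    have "0 \<notin> X"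
    proof
      assume "0 \<in> X"
      then obtain k s where ks: "0 = k + s *\<^sub>R x" "s > 0" "k \<in> K \<or> k = 0"
        using Kc(1) unfolding X_def by auto
      \<comment> \<open>With \<open>k = 0\<close> the equation would force \<open>x = 0\<close>.
        Otherwise \<open>- x\<close> is a positive multiple of \<open>k\<close>, hence in
        \<open>K\<close>, which was excluded.\<close>
      then have "k \<in> K" using that by auto
      have "k = - (s *\<^sub>R x)" using ks(1) by (simp add: eq_neg_iff_add_eq_0)
      then have "- x = (1/s) *\<^sub>R k" using ks(2) by simp
      then show False using Kc(3)[of "1/s" k] \<open>k \<in> K\<close> ks(2) no by auto
    qed
    moreover have "u + v \<in> X" if uv: "u \<in> X" "v \<in> X" for u v
    proof -
      \<comment> \<open>A common normal form, with \<open>s = 0\<close> for members of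
        \<open>K\<close>, so that one formula handles all sums.\<close>
      have X: "\<exists>k s. w = k + s *\<^sub>R x \<and> (k \<in> K \<and> s = 0 \<or> s > 0 \<and> (k \<in> K \<or> k = 0))"
        if "w \<in> X" for w
        using that unfolding X_def by force
      obtain k s where ks: "u = k + s *\<^sub>R x" "k \<in> K \<and> s = 0 \<or> s > 0 \<and> (k \<in> K \<or> k = 0)"
        using X[OF uv(1)] by auto
      obtain l t where lt: "v = l + t *\<^sub>R x" "l \<in> K \<and> t = 0 \<or> t > 0 \<and> (l \<in> K \<or> l = 0)"
        using X[OF uv(2)] by auto
      have "u + v = (k + l) + (s + t) *\<^sub>R x" using ks lt by (simp add: algebra_simps)
      moreover have "k + l \<in> K \<and> s + t = 0 \<or> s + t > 0 \<and> (k + l \<in> K \<or> k + l = 0)"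
        using ks(2) lt(2) Kc(2) by force
      ultimately show ?thesis unfolding X_def by force
    qed
    moreover have "c *\<^sub>R u \<in> X" if "c > 0" "u \<in> X" for c u
    proof (cases "u \<in> K")
      case False
      then obtain k s where "u = k + s *\<^sub>R x" "s > 0" "k \<in> K \<or> k = 0"
        using \<open>u \<in> X\<close> unfolding X_def by auto
      then have "c *\<^sub>R u = c *\<^sub>R k + (c * s) *\<^sub>R x" "c * s > 0" "c *\<^sub>R k \<in> K \<or> c *\<^sub>R k = 0"
        using Kc(3) \<open>c > 0\<close> by (auto simp: algebra_simps)
      then show ?thesis by auto
    qed (use Kc \<open>c > 0\<close> in auto)
    ultimately have "blunt_convex_cone X" unfolding blunt_convex_cone_def by auto
    then have "X = K" by (rule max) (auto simp: X_def)
    moreover have "0 + 1 *\<^sub>R x \<in> X" by (rule) auto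
    ultimately show False using no by auto
  qed
  with K show thesis by (rule that)
qed

section \<open>Separation by continuous functionals\<close>

text \<open>In the order of \<open>K\<close>, the reals \<open>t\<close> with \<open>t a\<close>
  below \<open>x\<close> form a Dedekind cut at \<open>p x\<close>. The order unit makes the cut
  proper; totality makes lower and upper estimates meet, which gives additivity. Positivity near
  \<open>a\<close> gives continuity.\<close>

lemma supporting_functional:
  fixes C :: "'a::locally_convex_space set"
  assumes "convex C" "0 \<notin> C" "interior C \<noteq> {}"
  obtains \<phi> where "\<And>y. y \<in> C \<Longrightarrow> pairing \<phi> y \<ge> 0"
    "\<And>y. y \<in> interior C \<Longrightarrow> pairing \<phi> y > 0"
proof -
  obtain a where a: "a \<in> interior C" using assms(3) by auto
  obtain K where K: "blunt_convex_cone K" "{c *\<^sub>R x | c x. c > 0 \<and> x \<in> C} \<subseteq> K"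
    and total: "\<And>x. x \<noteq> 0 \<Longrightarrow> x \<in> K \<or> - x \<in> K"
    using total_blunt_convex_cone_extension[OF blunt_convex_cone_of_convex[OF assms(1,2)]] by blast
  note Kc = blunt_convex_coneD[OF K(1)]
  have CK: "C \<subseteq> K" using K(2) by (force intro: exI[of _ 1])
  have aK: "a \<in> K" using CK a interior_subset by auto
  \<comment> \<open>\<open>a\<close> is an order unit: a small step from \<open>a\<close> in
    direction \<open>x\<close> stays in \<open>C\<close>, and rescaling by \<open>2/e\<close> gives
    the claim.\<close>
  have unit: "\<exists>t>0. x + t *\<^sub>R a \<in> K" for x
  proof -
    obtain e where e: "e > 0" "\<And>t. \<bar>t\<bar> < e \<Longrightarrow> a + t *\<^sub>R x \<in> interior C"
      using open_absorbs_direction[OF open_interior a] by blast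
    then have "a + (e/2) *\<^sub>R x \<in> interior C" by simp
    then have "a + (e/2) *\<^sub>R x \<in> K" using CK interior_subset by (meson subsetD)
    then have "(2/e) *\<^sub>R (a + (e/2) *\<^sub>R x) \<in> K" using e by (intro Kc(3)) auto
    then have "x + (2/e) *\<^sub>R a \<in> K" using e by (simp add: scaleR_add_right add.commute)
    then show ?thesis using e by (intro exI[of _ "2/e"]) auto
  qed
  define T where "T x = {t. x - t *\<^sub>R a \<in> K}" for x
  define p where "p x = Sup (T x)" for x
  have Tne: "T x \<noteq> {}" for x
  proof -
    obtain t where "x + t *\<^sub>R a \<in> K" using unit by blast
    then have "-t \<in> T x" unfolding T_def by auto
    then show ?thesis by auto
  qed
  have mult_a: "c *\<^sub>R a \<in> K \<longleftrightarrow> c > 0" for c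
  proof
    assume "c *\<^sub>R a \<in> K"
    show "c > 0"
    proof (rule ccontr)
      assume "\<not> c > 0"
      then consider "c = 0" | "- c > 0" by linarith
      then show False
      proof cases
        case 2
        then have "c *\<^sub>R a + (-c) *\<^sub>R a \<in> K" using Kc(3)[OF 2 aK] Kc(2) \<open>c *\<^sub>R a \<in> K\<close> by blast
        then show False using Kc(1) by simp
      qed (use \<open>c *\<^sub>R a \<in> K\<close> Kc(1) in auto)
    qed
  qed (use Kc(3) aK in auto)
  \<comment> \<open>Adding the two positive elements cancels \<open>x\<close> and leaves
    \<open>(t - s) a\<close>.\<close>
  have sep: "s < t" if "x - s *\<^sub>R a \<in> K" "t *\<^sub>R a - x \<in> K" for x s t
  proof -
    have "(x - s *\<^sub>R a) + (t *\<^sub>R a - x) \<in> K" using that by (rule Kc(2))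
    then have "(t - s) *\<^sub>R a \<in> K" by (simp add: algebra_simps)
    then show ?thesis using mult_a by auto
  qed
  have Tbdd: "bdd_above (T x)" for x
  proof -
    obtain t where "- x + t *\<^sub>R a \<in> K" using unit by blast
    then have "t *\<^sub>R a - x \<in> K" by simp
    then show ?thesis using sep unfolding T_def by (intro bdd_aboveI[of _ t]) (auto intro: less_imp_le)
  qed
  have p_ge: "t \<le> p x" if "x - t *\<^sub>R a \<in> K" for x t
    unfolding p_def using that Tbdd by (intro cSup_upper) (auto simp: T_def)
  have p_le: "p x \<le> t" if "t *\<^sub>R a - x \<in> K" for x t
    unfolding p_def using that Tne sep by (intro cSup_least) (auto simp: T_def intro: less_imp_le)
  have below: "x - t *\<^sub>R a \<in> K" if "t < p x" for x t
  proof -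
    obtain s where "s \<in> T x" "t < s"
      using \<open>t < p x\<close> unfolding p_def less_cSup_iff[OF Tne Tbdd] by blast
    then have "s > t" "x - s *\<^sub>R a \<in> K" unfolding T_def by auto
    then have "(x - s *\<^sub>R a) + (s - t) *\<^sub>R a \<in> K" using mult_a by (intro Kc(2)) auto
    then show ?thesis by (simp add: algebra_simps)
  qed
  have above: "t *\<^sub>R a - x \<in> K" if "p x < t" for x t
  proof -
    \<comment> \<open>At the midpoint, \<open>x - s a\<close> is not positive, so by totality
      \<open>s a - x\<close> is positive or zero. The leftover \<open>(t - s) a\<close> turns either
      case into strict positivity.\<close>
    define s where "s = (p x + t) / 2"
    have s: "p x < s" "s < t" using that unfolding s_def by auto
    have "x - s *\<^sub>R a \<notin> K" using p_ge[of x s] s by auto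
    then consider "s *\<^sub>R a - x = 0" | "s *\<^sub>R a - x \<in> K"
      using total[of "x - s *\<^sub>R a"] by (auto simp: algebra_simps)
    moreover have "(t - s) *\<^sub>R a \<in> K" using s mult_a by auto
    ultimately have "(s *\<^sub>R a - x) + (t - s) *\<^sub>R a \<in> K" using Kc(2) by (metis add_0)
    then show ?thesis by (simp add: algebra_simps)
  qed
  \<comment> \<open>Summing upper estimates \<open>p x + e/2\<close>, \<open>p y + e/2\<close>
    bounds \<open>p (x + y)\<close> from above; lower estimates bound it from below.\<close>
  have add: "p (x + y) = p x + p y" for x y
  proof (rule antisym; rule field_le_epsilon)
    fix e :: real assume "e > 0"
    then have "((p x + e/2) *\<^sub>R a - x) + ((p y + e/2) *\<^sub>R a - y) \<in> K"
      by (intro Kc(2) above) auto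
    moreover have "((p x + e/2) *\<^sub>R a - x) + ((p y + e/2) *\<^sub>R a - y)
        = (p x + p y + e) *\<^sub>R a - (x + y)"
      by (simp add: algebra_simps flip: scaleR_add_left)
    ultimately show "p (x + y) \<le> p x + p y + e" by (intro p_le) auto
    have "(x - (p x - e/2) *\<^sub>R a) + (y - (p y - e/2) *\<^sub>R a) \<in> K"
      using \<open>e > 0\<close> by (intro Kc(2) below) auto
    moreover have "(x - (p x - e/2) *\<^sub>R a) + (y - (p y - e/2) *\<^sub>R a)
        = (x + y) - (p x + p y - e) *\<^sub>R a"
      by (simp add: algebra_simps flip: scaleR_add_left)
    ultimately show "p x + p y \<le> p (x + y) + e" using p_ge[of "x + y" "p x + p y - e"] by auto
  qed
  have p0: "p 0 = 0" using add[of 0 0] by simp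
  have neg: "p (- x) = - p x" for x using add[of x "- x"] p0 by simp
  have scale_le: "c * p x \<le> p (c *\<^sub>R x)" if "c > 0" for c x
  proof (rule field_le_epsilon)
    fix e :: real assume "e > 0"
    then have "c *\<^sub>R (x - (p x - e/c) *\<^sub>R a) \<in> K"
      using that by (intro Kc(3) below) auto
    moreover have "c *\<^sub>R (x - (p x - e/c) *\<^sub>R a) = c *\<^sub>R x - (c * p x - e) *\<^sub>R a"
      using that by (simp add: algebra_simps)
    ultimately show "c * p x \<le> p (c *\<^sub>R x) + e" using p_ge[of "c *\<^sub>R x" "c * p x - e"] by auto
  qed
  \<comment> \<open>The reverse inequality is \<open>scale_le\<close> at \<open>- x\<close>.\<close>
  have scale_pos: "p (c *\<^sub>R x) = c * p x" if "c > 0" for c x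
    using scale_le[OF that, of x] scale_le[OF that, of "- x"] by (simp add: neg)
  have scale: "p (c *\<^sub>R x) = c * p x" for c x
    using scale_pos[of c x] scale_pos[of "-c" x] neg p0 by (cases c "0::real" rule: linorder_cases) auto
  have lin: "linear p" by (rule linearI) (auto simp: add scale)
  have nonneg: "p y \<ge> 0" if "y \<in> C" for y using p_ge[of y 0] that CK by auto
  have pa: "p a = 1"
  proof (rule antisym; rule field_le_epsilon)
    fix e :: real assume "e > 0"
    then have "e *\<^sub>R a \<in> K" using mult_a by simp
    then show "p a \<le> 1 + e" "1 \<le> p a + e"
      using p_le[of "1+e" a] p_ge[of a "1-e"] by (simp_all add: scaleR_left_distrib scaleR_left_diff_distrib)
  qed
  \<comment> \<open>A step of \<open>e/2\<close> against \<open>a\<close> stays in \<open>C\<close>,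
    where \<open>p\<close> is nonnegative, and it lowers \<open>p\<close> by exactly
    \<open>e/2\<close> because \<open>p a = 1\<close>.\<close>
  have pos: "p y > 0" if "y \<in> interior C" for y
  proof -
    obtain e where e: "e > 0" "\<And>t. \<bar>t\<bar> < e \<Longrightarrow> y + t *\<^sub>R a \<in> interior C"
      using open_absorbs_direction[OF open_interior \<open>y \<in> interior C\<close>] by blast
    then have "y + (-(e/2)) *\<^sub>R a \<in> interior C" by (intro e(2)) simp
    then have "y + (-(e/2)) *\<^sub>R a \<in> C" using interior_subset by (rule subsetD[rotated])
    from nonneg[OF this] have "p y \<ge> e/2" by (simp only: add scale pa)
    then show ?thesis using e by auto
  qed
  have cont: "continuous_on UNIV p"
    unfolding continuous_on_def
  proof (intro ballI tendstoI)
    fix x :: 'a and e :: real assume "e > 0"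
    \<comment> \<open>On \<open>?N c\<close> positivity of \<open>p\<close> on the interior reads
      \<open>1 + c (p z - p x) > 0\<close>. The two values \<open>1/e\<close> and
      \<open>-(1/e)\<close> together bound the difference by \<open>e\<close> on both sides.\<close>
    let ?N = "\<lambda>c. (\<lambda>z. a + c *\<^sub>R (z - x)) -` interior C"
    have "open (?N (1/e) \<inter> ?N (-(1/e)))"
      by (intro open_Int open_vimage continuous_on_add continuous_on_scaleR_lcs continuous_on_diff)
        auto
    moreover have "x \<in> ?N (1/e) \<inter> ?N (-(1/e))" using a by auto
    moreover have "dist (p z) (p x) < e" if "z \<in> ?N (1/e) \<inter> ?N (-(1/e))" for z
    proof -
      have "p (a + c *\<^sub>R (z + - x)) = 1 + c * (p z - p x)" for c
        by (simp only: add scale pa neg) simp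
      then have "p (a + c *\<^sub>R (z - x)) = 1 + c * (p z - p x)" for c by simp
      moreover have "p (a + (1/e) *\<^sub>R (z - x)) > 0" "p (a + (-(1/e)) *\<^sub>R (z - x)) > 0"
        using that by (auto intro!: pos)
      ultimately have "1 + (1/e) * (p z - p x) > 0" "1 + (-(1/e)) * (p z - p x) > 0" by metis+
      then have "e + (p z - p x) > 0" "e - (p z - p x) > 0"
        using \<open>e > 0\<close> by (auto simp: field_simps)
      then show ?thesis using \<open>e > 0\<close> by (simp add: dist_real_def abs_less_iff)
    qed
    ultimately show "\<forall>\<^sub>F z in at x within UNIV. dist (p z) (p x) < e"
      unfolding eventually_at_topological by blast
  qed
  have "pairing (Abs_top_dual p) = p" using lin cont by (intro Abs_top_dual_inverse) auto
  then show thesis using that[of "Abs_top_dual p"] nonneg pos by auto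
qed

text \<open>Points are closed, so some convex open \<open>W\<close> around 0 misses
  \<open>- y\<close>. Then \<open>y + W\<close> is open, convex and misses 0, and a functional
  positive on it is positive at \<open>y\<close>.\<close>

lemma nonzero_functional:
  assumes "(y :: 'a::locally_convex_space) \<noteq> 0"
  obtains \<phi> where "pairing \<phi> y \<noteq> 0"
proof -
  have "open (- {- y})" "0 \<in> - {- y}" using assms by auto
  then obtain W where W: "open W" "0 \<in> W" "W \<subseteq> - {- y}" "convex W"
    by (rule locally_convex_nhd)
  let ?A = "(+) y ` W"
  have "?A = (\<lambda>z. z - y) -` W" by (force simp: image_iff)
  then have "open ?A" using W(1) by (auto intro!: open_vimage continuous_on_diff)
  moreover have "0 \<notin> ?A" using W(3) by (auto simp: add_eq_0_iff)
  moreover have "y \<in> ?A" using W(2) by (auto intro!: image_eqI[of _ _ 0])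
  moreover have "convex ?A" using W(4) by (rule convex_translation)
  ultimately obtain \<phi> where "pairing \<phi> y > 0"
    using supporting_functional[of ?A] by (metis interior_open empty_iff)
  then show thesis using that by force
qed

text \<open>Thicken \<open>C\<close> to \<open>C - W\<close> with \<open>W\<close> a convex
  neighbourhood of 0 disjoint from \<open>C\<close>. The result is open, convex and misses 0, so
  strict positivity holds on all of it and in particular on \<open>C\<close>.\<close>

lemma separating_functional_closed:
  fixes C :: "'a::locally_convex_space set"
  assumes "convex C" "closed C" "0 \<notin> C" "C \<noteq> {}"
  obtains \<phi> where "\<And>y. y \<in> C \<Longrightarrow> pairing \<phi> y > 0"
proof -
  have "open (- C)" "0 \<in> - C" using assms by auto
  then obtain W where W: "open W" "0 \<in> W" "W \<subseteq> - C" "convex W"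
    by (rule locally_convex_nhd)
  define A where "A = (\<Union>c\<in>C. \<Union>w\<in>W. {c - w})"
  have "A = (\<Union>c\<in>C. (\<lambda>z. c - z) -` W)" unfolding A_def by (force simp: algebra_simps)
  moreover have "open (\<Union>c\<in>C. (\<lambda>z. c - z) -` W)"
    using W(1) by (auto intro!: open_vimage continuous_on_diff)
  ultimately have int: "interior A = A" by (simp add: interior_open)
  have CA: "C \<subseteq> A" unfolding A_def using W(2) by force
  have A: "convex A" "0 \<notin> A"
    unfolding A_def using W(3) convex_differences[OF assms(1) W(4)] by auto
  have "interior A \<noteq> {}" using CA int assms(4) by auto
  then obtain \<phi> where "\<And>y. y \<in> A \<Longrightarrow> pairing \<phi> y > 0"
    using supporting_functional[OF A] unfolding int by blast
  then show thesis using that CA by blast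
qed

section \<open>Bounded sets and rays in the strong dual\<close>

lemma tvs_boundedE:
  assumes "tvs_bounded B" "open V" "0 \<in> V"
  obtains s where "s > 0" "\<And>t. t > s \<Longrightarrow> B \<subseteq> (*\<^sub>R) t ` V"
  using assms(1)[unfolded tvs_bounded_def, rule_format, OF conjI[OF assms(2,3)]]
  by (elim exE conjE) (rule that, auto)

text \<open>The set where the functional has modulus below 1 is a neighbourhood of 0, so it absorbs
  \<open>B\<close>. The absorption factor must exceed \<open>s\<close> strictly, hence the bound
  \<open>s + 1\<close>.\<close>

lemma pairing_bounded_on_tvs_bounded:
  assumes "tvs_bounded B"
  obtains M where "M > 0" "\<And>y. y \<in> B \<Longrightarrow> \<bar>pairing \<phi> y\<bar> \<le> M"
proof -
  have "open (pairing \<phi> -` {-1<..<1})"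
    by (intro open_vimage continuous_on_pairing) auto
  moreover have "0 \<in> pairing \<phi> -` {-1<..<1}" by (simp add: linear_0[OF linear_pairing])
  ultimately obtain s where s: "s > 0" "\<And>t. t > s \<Longrightarrow> B \<subseteq> (*\<^sub>R) t ` (pairing \<phi> -` {-1<..<1})"
    using tvs_boundedE[OF assms] by blast
  have "\<bar>pairing \<phi> y\<bar> \<le> s + 1" if "y \<in> B" for y
  proof -
    obtain z where "y = (s+1) *\<^sub>R z" "z \<in> pairing \<phi> -` {-1<..<1}"
      using s(2)[of "s+1"] \<open>y \<in> B\<close> by (meson imageE less_add_one subsetD)
    then have "y = (s+1) *\<^sub>R z" "\<bar>pairing \<phi> z\<bar> \<le> 1" by auto
    then show ?thesis using s(1) mult_left_mono[of "\<bar>pairing \<phi> z\<bar>" 1 "s + 1"]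
      by (simp add: linear_cmul[OF linear_pairing] abs_mult)
  qed
  with s show thesis by (intro that[of "s+1"]) auto
qed

text \<open>Strong neighbourhoods test on a bounded \<open>B\<close>, where the functional is
  bounded by some \<open>M\<close>; moving the scalar by less than \<open>e / M\<close> changes the
  values by less than \<open>e\<close> uniformly on \<open>B\<close>.\<close>

lemma continuous_on_scaleR_top_dual:
  "continuous_on S (\<lambda>t. t *\<^sub>R (\<phi> :: 'a::locally_convex_space top_dual))"
proof -
  have "open ((\<lambda>t. t *\<^sub>R \<phi>) -` W)" if "open W" for W
    unfolding open_dist
  proof
    fix t assume "t \<in> (\<lambda>t. t *\<^sub>R \<phi>) -` W"
    then have "t *\<^sub>R \<phi> \<in> W" by simp
    then obtain B e where B: "tvs_bounded B" and e: "e > 0"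
      and W: "{\<psi>. \<forall>y\<in>B. \<bar>pairing \<psi> y - pairing (t *\<^sub>R \<phi>) y\<bar> < e} \<subseteq> W"
      using \<open>open W\<close> unfolding open_top_dual_def by blast
    obtain M where M: "M > 0" "\<And>y. y \<in> B \<Longrightarrow> \<bar>pairing \<phi> y\<bar> \<le> M"
      using pairing_bounded_on_tvs_bounded[OF B] by blast
    have "s *\<^sub>R \<phi> \<in> W" if "dist s t < e / M" for s
    proof -
      have "\<bar>pairing (s *\<^sub>R \<phi>) y - pairing (t *\<^sub>R \<phi>) y\<bar> < e" if "y \<in> B" for y
      proof -
        have "\<bar>pairing (s *\<^sub>R \<phi>) y - pairing (t *\<^sub>R \<phi>) y\<bar> = \<bar>s - t\<bar> * \<bar>pairing \<phi> y\<bar>"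
          by (simp add: scaleR_top_dual.rep_eq abs_mult flip: left_diff_distrib)
        also have "\<dots> \<le> \<bar>s - t\<bar> * M" using M \<open>y \<in> B\<close> by (intro mult_left_mono) auto
        also have "\<dots> < e" using \<open>dist s t < e / M\<close> M by (simp add: dist_real_def field_simps)
        finally show ?thesis .
      qed
      then show ?thesis using W by auto
    qed
    then show "\<exists>d>0. \<forall>s. dist s t < d \<longrightarrow> s \<in> (\<lambda>t. t *\<^sub>R \<phi>) -` W"
      using e M by (intro exI[of _ "e/M"]) auto
  qed
  then have "continuous_on UNIV (\<lambda>t. t *\<^sub>R \<phi>)"
    by (subst continuous_on_open_vimage) auto
  then show ?thesis by (rule continuous_on_subset) auto
qed

text \<open>Testing at the single point \<open>y\<close> suffices: singletons are bounded, so
  \<open>?V\<close> is a strong neighbourhood of 0. It absorbs \<open>U\<close>, which bounds all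
  values at \<open>y\<close> of members of \<open>U\<close>, while those along the ray grow without
  bound.\<close>

lemma ray_leaves_tvs_bounded:
  assumes "tvs_bounded U" "pairing \<phi> y \<noteq> 0"
  obtains s where "s > 0" "\<And>t. t > s \<Longrightarrow> t *\<^sub>R \<phi> \<notin> U"
proof -
  let ?V = "{\<psi>. \<bar>pairing \<psi> y\<bar> < 1}"
  have "tvs_bounded {y}"
    unfolding tvs_bounded_def
  proof (intro allI impI)
    fix V :: "'a set" assume V: "open V \<and> 0 \<in> V"
    then obtain e where e: "e > 0" "\<And>t. \<bar>t\<bar> < e \<Longrightarrow> 0 + t *\<^sub>R y \<in> V"
      using open_absorbs_direction[of V 0 y] by blast
    have "{y} \<subseteq> (*\<^sub>R) t ` V" if "t > 1/e" for t
    proof -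
      have "t > 0" using that e(1) less_trans[of 0 "1/e" t] by auto
      then have "0 + (1/t) *\<^sub>R y \<in> V" using that e by (intro e(2)) (auto simp: field_simps)
      then show ?thesis using \<open>t > 0\<close> by (auto intro!: image_eqI[of _ _ "(1/t) *\<^sub>R y"])
    qed
    then show "\<exists>s>0. \<forall>t>s. {y} \<subseteq> (*\<^sub>R) t ` V" using e by (intro exI[of _ "1/e"]) auto
  qed
  have "open ?V"
    unfolding open_top_dual_def
  proof
    fix \<psi> assume "\<psi> \<in> ?V"
    then show "\<exists>B e. tvs_bounded B \<and> e > 0 \<and>
        {\<theta>. \<forall>z\<in>B. \<bar>pairing \<theta> z - pairing \<psi> z\<bar> < e} \<subseteq> ?V"
      using \<open>tvs_bounded {y}\<close>
      by (intro exI[of _ "{y}"] exI[of _ "1 - \<bar>pairing \<psi> y\<bar>"]) auto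
  qed
  moreover have "0 \<in> ?V" by (simp add: zero_top_dual.rep_eq)
  ultimately obtain s where s: "s > 0" "\<And>t. t > s \<Longrightarrow> U \<subseteq> (*\<^sub>R) t ` ?V"
    using tvs_boundedE[OF assms(1)] by blast
  have "t *\<^sub>R \<phi> \<notin> U" if t: "t > (s + 1) / \<bar>pairing \<phi> y\<bar>" for t
  proof
    assume "t *\<^sub>R \<phi> \<in> U"
    then obtain \<psi> where "t *\<^sub>R \<phi> = (s+1) *\<^sub>R \<psi>" "\<bar>pairing \<psi> y\<bar> < 1" using s(2)[of "s+1"] by auto
    then have "t * pairing \<phi> y = (s+1) * pairing \<psi> y" by (metis scaleR_top_dual.rep_eq)
    then have "\<bar>t\<bar> * \<bar>pairing \<phi> y\<bar> = (s+1) * \<bar>pairing \<psi> y\<bar>"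
      using s(1) by (metis abs_mult abs_of_pos add_pos_pos zero_less_one)
    also have "\<dots> \<le> s + 1" using s(1) \<open>\<bar>pairing \<psi> y\<bar> < 1\<close> by (simp add: mult_left_le)
    finally show False using t assms(2) by (simp add: field_simps)
       (smt (verit) mult_right_mono abs_ge_self abs_ge_zero mult.commute)
  qed
  then show thesis using s assms(2) by (intro that[of "(s + 1) / \<bar>pairing \<phi> y\<bar>"]) auto
qed

text \<open>The origin itself may lie on the frontier, since an absorbing set need not be a strong
  neighbourhood of 0; the ray is therefore started at a positive multiple of the functional.\<close>

lemma ray_meets_frontier:
  assumes "tvs_bounded U" "absorbing U" "pairing \<phi> y \<noteq> 0"
  obtains t where "t > 0" "t *\<^sub>R \<phi> \<in> frontier U"
proof -
  obtain r where r: "r > 0" "r *\<^sub>R \<phi> \<in> U"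
    using assms(2) unfolding absorbing_def by (metis abs_of_pos order_refl)
  obtain s where s: "s > 0" "\<And>t. t > s \<Longrightarrow> t *\<^sub>R \<phi> \<notin> U"
    using ray_leaves_tvs_bounded[OF assms(1,3)] by blast
  let ?R = "(\<lambda>t. t *\<^sub>R \<phi>) ` {r..}"
  have "connected ?R"
    by (intro connected_continuous_image continuous_on_scaleR_top_dual) simp
  moreover have "?R \<inter> U \<noteq> {}" using r by auto
  \<comment> \<open>The parameter \<open>max r (s+1)\<close> is on the ray and past the exit
    threshold \<open>s\<close>; connectedness then yields a frontier point.\<close>
  moreover have "?R - U \<noteq> {}"
    using s(2)[of "max r (s+1)"] by (auto intro!: image_eqI[of _ _ "max r (s+1)"])
  ultimately have "?R \<inter> frontier U \<noteq> {}" by (rule connected_Int_frontier)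
  then show thesis using r that by fastforce
qed

section \<open>Frontier functionals force the origin into the image\<close>

text \<open>The assumption \<open>nondegenerate\<close> excludes one degenerate case: over the zero
  space the dual is zero and \<open>U\<close> is all of it, so its frontier is empty and with empty
  \<open>G\<close> the closed case would hold vacuously.\<close>

theorem theorem8:
  fixes f :: "'x::locally_convex_space \<Rightarrow> 'y::locally_convex_space set"
    and D G :: "'x set"
    and U :: "'y top_dual set"
  assumes U: "convex U" "closed U" "tvs_bounded U" "absorbing U"
    and f: "\<forall>x\<in>D. f x \<noteq> {}"
    and G: "G \<subseteq> D"
    and nondegenerate: "(UNIV :: 'y set) = {0} \<longrightarrow> G \<noteq> {}"
    and cases:
      "(convex (multi_image f G) \<and> interior (multi_image f G) \<noteq> {} \<and>
          (\<forall>\<phi>\<in>frontier U. \<exists>x\<in>G. {pairing \<phi> y | y. y \<in> f x} \<inter> {0<..} \<noteq> {}))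
       \<or> (convex (multi_image f G) \<and> (open (multi_image f G) \<or> closed (multi_image f G)) \<and>
          (\<forall>\<phi>\<in>frontier U. \<exists>x\<in>G. {pairing \<phi> y | y. y \<in> f x} \<inter> {0..} \<noteq> {}))"
  shows "0 \<in> multi_image f G"
proof (rule ccontr)
  let ?C = "multi_image f G"
  assume no: "0 \<notin> ?C"
  have frontier: "\<exists>t>0. t *\<^sub>R \<phi> \<in> frontier U" if "pairing \<phi> y \<noteq> 0" for \<phi> y
    using ray_meets_frontier[OF U(3,4) that] by blast
  \<comment> \<open>In the zero space a nonempty image would contain 0, so there is a nonzero
    vector.\<close>
  have "multi_image f G \<noteq> {}" if "(UNIV :: 'y set) = {0}"
    using mp[OF nondegenerate that] f G unfolding multi_image_def by blast
  then have "(UNIV :: 'y set) \<noteq> {0}" using no by (metis UNIV_I all_not_in_conv singletonD)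
  then obtain z :: 'y where "z \<noteq> 0" by auto
  \<comment> \<open>A nonzero functional yields a frontier point, and the hypothesis there supplies
    an actual value of \<open>f\<close> on \<open>G\<close>.\<close>
  obtain \<phi>\<^sub>0 where "pairing \<phi>\<^sub>0 z \<noteq> 0" using nonzero_functional[OF \<open>z \<noteq> 0\<close>] .
  then obtain \<phi>\<^sub>1 where "\<phi>\<^sub>1 \<in> frontier U" using frontier by blast
  then have ne: "?C \<noteq> {}" using cases unfolding multi_image_def by fastforce
  from cases show False
  proof
    assume "convex ?C \<and> interior ?C \<noteq> {} \<and>
      (\<forall>\<phi>\<in>frontier U. \<exists>x\<in>G. {pairing \<phi> y | y. y \<in> f x} \<inter> {0<..} \<noteq> {})"
    then have C: "convex ?C" "interior ?C \<noteq> {}"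
      and *: "\<forall>\<phi>\<in>frontier U. \<exists>x\<in>G. {pairing \<phi> y | y. y \<in> f x} \<inter> {0<..} \<noteq> {}"
      by blast+
    obtain \<phi> where \<phi>: "\<And>y. y \<in> ?C \<Longrightarrow> pairing \<phi> y \<ge> 0"
      "\<And>y. y \<in> interior ?C \<Longrightarrow> pairing \<phi> y > 0"
      using supporting_functional[OF C(1) no C(2)] by blast
    \<comment> \<open>An interior point, where \<open>\<phi>\<close> is strictly positive, shows
      \<open>- \<phi>\<close> to be nonzero, so its ray reaches the frontier. There all values on
      the image are at most 0.\<close>
    obtain t where t: "t > 0" "t *\<^sub>R (-\<phi>) \<in> frontier U"
      using C(2) \<phi>(2) frontier[of "- \<phi>"] by (fastforce simp: uminus_top_dual.rep_eq)
    then obtain y where "y \<in> ?C" "pairing (t *\<^sub>R (-\<phi>)) y > 0"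
      using * unfolding multi_image_def by fastforce
    then show False using \<phi>(1)[of y] t(1)
      by (simp add: scaleR_top_dual.rep_eq uminus_top_dual.rep_eq mult_less_0_iff)
  next
    assume "convex ?C \<and> (open ?C \<or> closed ?C) \<and>
      (\<forall>\<phi>\<in>frontier U. \<exists>x\<in>G. {pairing \<phi> y | y. y \<in> f x} \<inter> {0..} \<noteq> {})"
    then have C: "convex ?C" "open ?C \<or> closed ?C"
      and *: "\<forall>\<phi>\<in>frontier U. \<exists>x\<in>G. {pairing \<phi> y | y. y \<in> f x} \<inter> {0..} \<noteq> {}"
      by blast+
    \<comment> \<open>Strictness on the whole image is essential, since the hypothesis only gives a
      value at least 0. An open image is its own interior; a closed one uses the thickening.\<close>
    obtain \<phi> where \<phi>: "\<And>y. y \<in> ?C \<Longrightarrow> pairing \<phi> y > 0"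
      using C(2) supporting_functional[OF C(1) no] separating_functional_closed[OF C(1) _ no ne] ne
      by (metis interior_open)
    obtain t where t: "t > 0" "t *\<^sub>R (-\<phi>) \<in> frontier U"
      using ne \<phi> frontier[of "- \<phi>"] by (fastforce simp: uminus_top_dual.rep_eq)
    then obtain y where "y \<in> ?C" "pairing (t *\<^sub>R (-\<phi>)) y \<ge> 0"
      using * unfolding multi_image_def by fastforce
    then show False using \<phi>[of y] t(1)
      by (simp add: scaleR_top_dual.rep_eq uminus_top_dual.rep_eq mult_le_0_iff)
  qed
qed

end
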